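(* Let $n\geq 2$, $F=x_0^{d_0}\cdots x_n^{d_n}$ with $1\leq d_0\leq \cdots \leq d_n$, and $m=\max \{ i \mid d_0=d_i \}$. If $d_0\geq 2$ then $\mathcal{F}(F)\subsetneq \mathrm{Eig}(F)$; otherwise $\mathrm{Eig}(F)\cap\mathcal{F}(F)=\bigcup_{i=0}^{m} \bigcup_{j\neq i} H_{i,j}$, where $H_{i,j}=V(x_i,x_j)$. In particular, in all cases we have $\mathrm{Eig}(F)\cap \mathcal{W}(F)\neq \emptyset$.
   Context: Work over $\mathbb{C}$ with forms in $\mathbb{C}[x_0,\dots,x_n]$; let $d=d_0+\dots+d_n$ be the degree of $F$. A linear form $p_0x_0+\dots+p_nx_n$ is identified with the point $[p_0:\dots:p_n]\in\mathbb{P}^n=\mathbb{P}(\mathrm{Sym}^1(\mathbb{C}^{n+1}))$, and $V(x_i,x_j)$ denotes the locus $p_i=p_j=0$ in this $\mathbb{P}^n$; the index $j$ in the union ranges over $\{0,\dots,n\}\setminus\{i\}$. The Waring rank $\mathrm{rk}(F)$ is the minimal $r$ such that $F=\sum_{i=1}^rL_i^d$ with $L_i$ linear forms. The Waring locus $\mathcal{W}(F)$ is the set of $[L]$ such that $F\in\langle L^d,L_2^d,\dots,L_r^d\rangle$ for some linear forms $L_2,\dots,L_r$, with $r=\mathrm{rk}(F)$; the forbidden locus $\mathcal{F}(F)$ is its complement in $\mathbb{P}(\mathrm{Sym}^1(\mathbb{C}^{n+1}))$. The eigenscheme $\mathrm{Eig}(F)$ is the scheme in $\mathbb{P}(\mathrm{Sym}^1(\mathbb{C}^{n+1}))$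 defined by the vanishing of the $2\times 2$ minors of the matrix with rows $\nabla F(x)$ and $x=(x_0,\dots,x_n)$. *)

theory Defs
  imports Complex_Main "HOL-Library.Poly_Mapping"
begin

text \<open>
  Complex polynomials in the variables $x_0, x_1, x_2, \ldots$: an exponent vector
  \<open>nat \<Rightarrow>\<^sub>0 nat\<close> is mapped to its coefficient, and multiplication is the convolution
  product of the library. Forms in $x_0,\ldots,x_n$ are such polynomials in which only these
  variables occur.
\<close>

type_synonym cpoly = "(nat \<Rightarrow>\<^sub>0 nat) \<Rightarrow>\<^sub>0 complex"

definition cX :: "nat \<Rightarrow> cpoly" where
  "cX i = Poly_Mapping.single (Poly_Mapping.single i 1) 1"

definition cscale :: "complex \<Rightarrow> cpoly \<Rightarrow> cpoly" where
  "cscale c f = Poly_Mapping.single 0 c * f"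

interpretation cpoly: vector_space cscale
proof
  show "cscale a (cscale b x) = cscale (a * b) x" for a b x
    by (simp add: cscale_def mult_single flip: mult.assoc)
  show "cscale 1 x = x" for x
    by (simp add: cscale_def)
qed (simp_all add: cscale_def single_add distrib_left distrib_right)

definition ceval :: "(nat \<Rightarrow> complex) \<Rightarrow> cpoly \<Rightarrow> complex" where
  "ceval p f = (\<Sum>a\<in>Poly_Mapping.keys f. Poly_Mapping.lookup f a *
     (\<Prod>i\<in>Poly_Mapping.keys a. p i ^ Poly_Mapping.lookup a i))"

text \<open>
  In the formal partial derivative the truncated subtraction of exponents is harmless: for a
  monomial not containing $x_i$ the coefficient is multiplied by $0$.
\<close>

definition cpderiv :: "nat \<Rightarrow> cpoly \<Rightarrow> cpoly" where
  "cpderiv i f = (\<Sum>a\<in>Poly_Mapping.keys f. Poly_Mapping.single (a - Poly_Mapping.single i 1)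
     (of_nat (Poly_Mapping.lookup a i) * Poly_Mapping.lookup f a))"

text \<open>
  Elements of $\mathbb{C}^{n+1}$ are the functions that vanish beyond index \<open>n\<close>, and
  \<open>lform n p\<close> is the linear form $p_0x_0+\cdots+p_nx_n$. The projective space
  $\mathbb{P}(\mathrm{Sym}^1(\mathbb{C}^{n+1}))$ is the set of classes \<open>proj_pt p\<close> of nonzero
  \<open>p\<close> modulo nonzero scalars, where \<open>proj_pt p\<close> is the point $[L]$ of the linear form
  $L =$ \<open>lform n p\<close>.
\<close>

definition cvecs :: "nat \<Rightarrow> (nat \<Rightarrow> complex) set" where
  "cvecs n = {p. \<forall>i>n. p i = 0}"

definition lform :: "nat \<Rightarrow> (nat \<Rightarrow> complex) \<Rightarrow> cpoly" where
  "lform n p = (\<Sum>i\<le>n. cscale (p i) (cX i))"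

definition linear_forms :: "nat \<Rightarrow> cpoly set" where
  "linear_forms n = lform n ` cvecs n"

definition proj_pt :: "(nat \<Rightarrow> complex) \<Rightarrow> (nat \<Rightarrow> complex) set" where
  "proj_pt p = {(\<lambda>i. c * p i) | c. c \<noteq> 0}"

definition proj_space :: "nat \<Rightarrow> (nat \<Rightarrow> complex) set set" where
  "proj_space n = proj_pt ` (cvecs n - {\<lambda>_. 0})"

text \<open>Closed points of the projective scheme defined by the homogeneous polynomials in \<open>S\<close>.\<close>

definition proj_zeros :: "nat \<Rightarrow> cpoly set \<Rightarrow> (nat \<Rightarrow> complex) set set" where
  "proj_zeros n S = {P \<in> proj_space n. \<forall>p\<in>P. \<forall>f\<in>S. ceval p f = 0}"

text \<open>
  In the following two definitions \<open>F\<close> is meant to be a form of degree \<open>d\<close> in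
  $x_0,\ldots,x_n$. For $d \ge 1$ it is a sum of \<open>d\<close>-th powers of linear forms, so that the
  minimum exists.
\<close>

definition waring_rank :: "nat \<Rightarrow> nat \<Rightarrow> cpoly \<Rightarrow> nat" where
  "waring_rank n d F =
     (LEAST r. \<exists>L. (\<forall>i\<in>{1..r}. L i \<in> linear_forms n) \<and> F = (\<Sum>i=1..r. L i ^ d))"

definition waring_locus :: "nat \<Rightarrow> nat \<Rightarrow> cpoly \<Rightarrow> (nat \<Rightarrow> complex) set set" where
  "waring_locus n d F =
     {proj_pt p | p. p \<in> cvecs n - {\<lambda>_. 0} \<and>
        (\<exists>L. (\<forall>i\<in>{2..waring_rank n d F}. L i \<in> linear_forms n) \<and>
             F \<in> cpoly.span (insert (lform n p ^ d) ((\<lambda>i. L i ^ d) ` {2..waring_rank n d F})))}"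

definition forbidden_locus :: "nat \<Rightarrow> nat \<Rightarrow> cpoly \<Rightarrow> (nat \<Rightarrow> complex) set set" where
  "forbidden_locus n d F = proj_space n - waring_locus n d F"

text \<open>
  The forbidden locus is only a set of points, so the eigenscheme enters through its set of closed
  points; the generators are the $2\times 2$ minors of the matrix with rows $\nabla F$ and $x$.
\<close>

definition eig_minors :: "nat \<Rightarrow> cpoly \<Rightarrow> cpoly set" where
  "eig_minors n F = {cpderiv i F * cX j - cpderiv j F * cX i | i j. i < j \<and> j \<le> n}"

definition eigenscheme :: "nat \<Rightarrow> cpoly \<Rightarrow> (nat \<Rightarrow> complex) set set" where
  "eigenscheme n F = proj_zeros n (eig_minors n F)"

end

theory Submission
  imports Defs "HOL-Library.FuncSet"
begin

text \<open>
  Let $d_0$ be the minimal exponent. Everything rests on the description of the Waring locus of a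
  monomial: $[p]$ is in $\mathcal{W}(F)$ iff $p_i \neq 0$ for every \<open>i\<close> with $d_i = d_0$
  (\<open>waring_locus_monomial\<close>), that is, the forbidden locus is $V(x_0 \cdots x_m)$.

  By the multinomial theorem (\<open>lookup_lform_power\<close>), $F = \sum_t c_t L_t^d$ says that the functional
  $\sum_t c_t\,\mathrm{ev}_{L_t}$ on forms of degree \<open>d\<close> is, up to a nonzero factor, taking the
  coefficient of the monomial \<open>F\<close>. Two facts about such functionals give the rank
  $\prod_{k\ge 1}(d_k+1)$ and the Waring locus.

  \<^item> The number of points with $p_i \neq 0$ is at least $\prod_{k\neq i}(d_k+1)$, because the divisors
    of \<open>F\<close> free of $x_i$ are linearly independent functions on these points of the chart $x_i = 1$
    (\<open>points_off_hyperplane_lower_bound\<close>). For $d_i = d_0$ this bound is the rank, so a minimal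
    decomposition has no point on $x_i = 0$.

  \<^item> If $p_i \neq 0$ whenever $d_i = d_0$, a grid of $\prod_{k\ge 1}(d_k+1)$ points containing \<open>p\<close>
    carries such a functional, a product of functionals in one variable supported on (scaled)
    roots of unity and possibly \<open>0\<close> (\<open>monomial_power_sum_through_point\<close>).

  The rest is a computation with the gradient of a monomial. If $d_0 \ge 2$, then $\nabla F$ vanishes
  as soon as one coordinate does, so $\mathcal{F}(F) \subseteq \mathrm{Eig}(F)$. If $d_0 = 1$, a point with
  $p_i = 0$ and $d_i = 1$ is an eigenpoint iff a second coordinate vanishes. In all cases
  $[\sqrt{d_0} : \dots : \sqrt{d_n}]$ is an eigenpoint with no vanishing coordinate, hence in the
  Waring locus; this also makes the inclusion strict.
\<close>

section \<open>Monomials and their coefficients in powers of linear forms\<close>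

definition monval :: "(nat \<Rightarrow> complex) \<Rightarrow> (nat \<Rightarrow>\<^sub>0 nat) \<Rightarrow> complex" where
  "monval p a = (\<Prod>i\<in>Poly_Mapping.keys a. p i ^ Poly_Mapping.lookup a i)"

lemma monval_superset:
  assumes "finite A" "Poly_Mapping.keys a \<subseteq> A"
  shows "monval p a = (\<Prod>i\<in>A. p i ^ Poly_Mapping.lookup a i)"
  unfolding monval_def using assms
  by (intro prod.mono_neutral_left) (auto simp: in_keys_iff)

lemma monval_add: "monval p (a + b) = monval p a * monval p b"
proof -
  let ?A = "Poly_Mapping.keys a \<union> Poly_Mapping.keys b"
  have "Poly_Mapping.keys (a + b) \<subseteq> ?A" by (rule keys_add)
  then show ?thesis
    by (simp add: monval_superset[of ?A] lookup_add power_add prod.distrib)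
qed

lemma monval_single: "monval p (Poly_Mapping.single i k) = p i ^ k"
  by (simp add: monval_def)

lemma monval_eq_0_iff: "monval p a = 0 \<longleftrightarrow> (\<exists>i. p i = 0 \<and> Poly_Mapping.lookup a i > 0)"
  by (auto simp: monval_def in_keys_iff)

lemma ceval_superset:
  assumes "finite A" "Poly_Mapping.keys f \<subseteq> A"
  shows "ceval p f = (\<Sum>a\<in>A. Poly_Mapping.lookup f a * monval p a)"
  unfolding ceval_def monval_def using assms
  by (intro sum.mono_neutral_left) (auto simp: in_keys_iff)

lemma ceval_diff: "ceval p (f - g) = ceval p f - ceval p g"
proof -
  let ?A = "Poly_Mapping.keys f \<union> Poly_Mapping.keys g"
  have "Poly_Mapping.keys (f - g) \<subseteq> ?A"
    by (auto simp: in_keys_iff lookup_minus)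
  then show ?thesis
    by (simp add: ceval_superset[of ?A] lookup_minus sum_subtractf algebra_simps)
qed

lemma ceval_single: "ceval p (Poly_Mapping.single a c) = c * monval p a"
  by (subst ceval_superset[of "{a}"]) auto

lemma ceval_cX: "ceval p (cX i) = p i"
  by (simp add: cX_def ceval_single monval_single)

text \<open>
  The exponents of \<open>F\<close> are given as a function on \<open>nat\<close> with arbitrary values beyond \<open>n\<close>,
  which have to be cut off to obtain an exponent vector.
\<close>

definition expo :: "nat \<Rightarrow> (nat \<Rightarrow> nat) \<Rightarrow> (nat \<Rightarrow>\<^sub>0 nat)" where
  "expo n \<alpha> = (\<Sum>i\<le>n. Poly_Mapping.single i (\<alpha> i))"

lemma lookup_expo: "Poly_Mapping.lookup (expo n \<alpha>) i = (if i \<le> n then \<alpha> i else 0)"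
  by (simp add: expo_def lookup_sum lookup_single when_def)

lemma keys_expo: "Poly_Mapping.keys (expo n \<alpha>) \<subseteq> {..n}"
  by (auto simp: in_keys_iff lookup_expo split: if_splits)

lemma expo_eq_iff: "expo n \<alpha> = expo n \<beta> \<longleftrightarrow> (\<forall>i\<le>n. \<alpha> i = \<beta> i)"
  by (auto simp: poly_mapping_eq_iff fun_eq_iff lookup_expo)

lemma monval_expo: "monval p (expo n \<alpha>) = (\<Prod>i\<le>n. p i ^ \<alpha> i)"
  by (subst monval_superset[OF _ keys_expo]) (auto simp: lookup_expo)

lemma expo_lookup:
  assumes "Poly_Mapping.keys a \<subseteq> {..n}"
  shows "expo n (Poly_Mapping.lookup a) = a"
  using assms by (intro poly_mapping_eqI) (force simp: lookup_expo in_keys_iff)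

lemma cX_power: "cX i ^ k = Poly_Mapping.single (Poly_Mapping.single i k) 1"
  by (induction k) (simp_all add: cX_def mult_single flip: single_add)

lemma monomial_eq_single:
  "(\<Prod>i=0..n. cX i ^ e i) = Poly_Mapping.single (expo n e) 1"
proof (induction n)
  case 0
  then show ?case by (simp add: cX_power expo_def)
next
  case (Suc n)
  then show ?case by (simp add: cX_power expo_def mult_single add.commute)
qed

lemma lookup_cscale: "Poly_Mapping.lookup (cscale c f) a = c * Poly_Mapping.lookup f a"
proof -
  have "cscale c f = Poly_Mapping.map ((*) c) f"
    by (simp add: cscale_def mult_map_scale_conv_mult)
  then show ?thesis
    by (simp add: Poly_Mapping.map.rep_eq when_def)
qed

lemma lookup_cX_times:
  "Poly_Mapping.lookup (cX i * f) a =
    (if Poly_Mapping.lookup a i > 0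
     then Poly_Mapping.lookup f (a - Poly_Mapping.single i 1) else 0)"
proof -
  let ?x = "Poly_Mapping.single i (1::nat)"
  have shift: "?x + b = a \<longleftrightarrow> Poly_Mapping.lookup a i > 0 \<and> b = a - ?x" for b
    by (auto simp: poly_mapping_eq_iff fun_eq_iff lookup_add lookup_minus lookup_single when_def
        split: if_splits)
  have f: "f = (\<Sum>b\<in>Poly_Mapping.keys f. Poly_Mapping.single b (Poly_Mapping.lookup f b))"
    by (rule poly_mapping_eqI) (simp add: lookup_sum lookup_single when_def in_keys_iff)
  have "cX i * f = (\<Sum>b\<in>Poly_Mapping.keys f.
      Poly_Mapping.single (?x + b) (Poly_Mapping.lookup f b))"
    by (subst f) (simp add: cX_def sum_distrib_left mult_single)
  then have "Poly_Mapping.lookup (cX i * f) a = (\<Sum>b\<in>Poly_Mapping.keys f.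
      if b = a - ?x \<and> Poly_Mapping.lookup a i > 0 then Poly_Mapping.lookup f b else 0)"
    by (simp add: lookup_sum lookup_single when_def shift conj_commute del: One_nat_def)
  also have "\<dots> = (if Poly_Mapping.lookup a i > 0 then Poly_Mapping.lookup f (a - ?x) else 0)"
    by (auto simp: in_keys_iff)
  finally show ?thesis .
qed

definition multinom :: "nat \<Rightarrow> (nat \<Rightarrow>\<^sub>0 nat) \<Rightarrow> complex" where
  "multinom n a = fact (\<Sum>k\<le>n. Poly_Mapping.lookup a k) / (\<Prod>k\<le>n. fact (Poly_Mapping.lookup a k))"

lemma multinom_nonzero: "multinom n a \<noteq> 0"
  by (simp add: multinom_def)

text \<open>
  The multinomial theorem, read off coefficientwise, by induction on the degree: comparing the
  coefficients of $x^a$ in $L^{d+1} = \sum_i p_i x_i L^d$ leaves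
  $(\sum_i a_i)\, d!/\prod_k a_k! = (d+1)!/\prod_k a_k!$.
  What matters later is that the coefficient depends on \<open>p\<close> only through the value of the
  monomial $x^a$ at \<open>p\<close>. Hence a linear combination of powers of linear forms is the monomial
  \<open>F\<close> iff the corresponding combination of point evaluations, as a functional on the forms of
  degree \<open>d\<close>, kills every monomial except \<open>F\<close>, on which it has a fixed nonzero value.
\<close>

lemma lookup_lform_power:
  "Poly_Mapping.lookup (lform n p ^ d) a =
    (if Poly_Mapping.keys a \<subseteq> {..n} \<and> (\<Sum>k\<le>n. Poly_Mapping.lookup a k) = d
     then multinom n a * monval p a else 0)"
proof (induction d arbitrary: a)
  case 0
  have "Poly_Mapping.keys a \<subseteq> {..n} \<and> (\<Sum>k\<le>n. Poly_Mapping.lookup a k) = 0 \<longleftrightarrow> a = 0"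
    by (auto simp: poly_mapping_eq_iff fun_eq_iff in_keys_iff subset_iff)
  then show ?case
    by (auto simp: lookup_one multinom_def monval_def when_def)
next
  case (Suc d)
  let ?l = "Poly_Mapping.lookup" and ?k = "Poly_Mapping.keys"
  let ?a = "\<lambda>i. a - Poly_Mapping.single i 1"
  have "?l (lform n p ^ Suc d) a =
      (\<Sum>i\<le>n. p i * (if ?l a i > 0 then ?l (lform n p ^ d) (?a i) else 0))"
    (is "_ = (\<Sum>i\<le>n. ?t i)")
  proof -
    have "lform n p ^ Suc d = (\<Sum>i\<le>n. cscale (p i) (cX i * lform n p ^ d))"
      by (simp add: lform_def sum_distrib_right cscale_def mult.assoc)
    then show ?thesis
      by (simp add: lookup_sum lookup_cscale lookup_cX_times)
  qed
  moreover have "?t i = (if ?k a \<subseteq> {..n} \<and> (\<Sum>k\<le>n. ?l a k) = Suc d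
      then of_nat (?l a i) * (fact d / (\<Prod>k\<le>n. fact (?l a k)) * monval p a) else 0)"
    if i: "i \<le> n" for i
  proof (cases "?l a i > 0")
    case True
    have a: "a = ?a i + Poly_Mapping.single i 1"
      using True by (auto simp: poly_mapping_eq_iff fun_eq_iff lookup_add lookup_minus
          lookup_single when_def)
    have keys: "?k (?a i) \<subseteq> {..n} \<longleftrightarrow> ?k a \<subseteq> {..n}"
      using i True by (auto simp: subset_iff in_keys_iff lookup_minus lookup_single when_def)
    have la: "?l a k = ?l (?a i) k + (if k = i then 1 else 0)" for k
      by (subst a) (auto simp: lookup_add lookup_single when_def)
    have deg: "(\<Sum>k\<le>n. ?l a k) = Suc (\<Sum>k\<le>n. ?l (?a i) k)"
      using i by (simp add: la sum.distrib del: lookup_minus)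
    have mv: "monval p a = p i * monval p (?a i)"
      by (subst a) (simp add: monval_add monval_single)
    have "(\<Prod>k\<le>n. fact (?l a k)) =
        (\<Prod>k\<le>n. (if k = i then of_nat (?l a i) else 1) * fact (?l (?a i) k) :: complex)"
      by (rule prod.cong) (auto simp: la)
    then have fa: "(\<Prod>k\<le>n. fact (?l a k)) = of_nat (?l a i) * (\<Prod>k\<le>n. fact (?l (?a i) k) :: complex)"
      using i by (simp add: prod.distrib)
    show ?thesis
      using True by (simp add: Suc.IH keys deg mv fa multinom_def del: One_nat_def)
  next
    case False
    then show ?thesis by simp
  qed
  moreover have "(\<Sum>i\<le>n. if C then of_nat (?l a i) * X else 0) =
      (if C then (\<Sum>i\<le>n. of_nat (?l a i)) * X else 0)" for C and X :: complex
    by (simp add: sum_distrib_right)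
  ultimately have "?l (lform n p ^ Suc d) a = (if ?k a \<subseteq> {..n} \<and> (\<Sum>k\<le>n. ?l a k) = Suc d
      then (\<Sum>i\<le>n. of_nat (?l a i)) * (fact d / (\<Prod>k\<le>n. fact (?l a k)) * monval p a) else 0)"
    by simp
  moreover have "(\<Sum>i\<le>n. of_nat (?l a i)) = (of_nat (\<Sum>i\<le>n. ?l a i) :: complex)"
    by simp
  ultimately show ?case
    by (auto simp: multinom_def simp del: of_nat_sum)
qed

lemma lookup_lform_power_expo:
  "Poly_Mapping.lookup (lform n p ^ d) (expo n \<alpha>) =
    (if (\<Sum>k\<le>n. \<alpha> k) = d then multinom n (expo n \<alpha>) * (\<Prod>k\<le>n. p k ^ \<alpha> k) else 0)"
proof -
  have "(\<Sum>k\<le>n. Poly_Mapping.lookup (expo n \<alpha>) k) = (\<Sum>k\<le>n. \<alpha> k)"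
    by (rule sum.cong) (auto simp: lookup_expo)
  then show ?thesis
    by (simp add: lookup_lform_power keys_expo monval_expo)
qed

section \<open>Lower bound: points off a coordinate hyperplane\<close>

text \<open>
  Gaussian elimination: a pivot \<open>v b0 j0\<close> is used to eliminate the unknown \<open>b0\<close> together with the
  equation \<open>j0\<close>.
\<close>

lemma homogeneous_system_nontrivial_solution:
  fixes v :: "'b \<Rightarrow> 'j \<Rightarrow> 'a::field"
  assumes "finite J" "finite B" "card J < card B"
  shows "\<exists>a. (\<exists>b\<in>B. a b \<noteq> 0) \<and> (\<forall>j\<in>J. (\<Sum>b\<in>B. a b * v b j) = 0)"
  using assms
proof (induction J arbitrary: B v rule: finite_induct)
  case empty
  then have "B \<noteq> {}" by auto
  then show ?case by (auto intro!: exI[of _ "\<lambda>_. 1"])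
next
  case (insert j0 J)
  show ?case
  proof (cases "\<forall>b\<in>B. v b j0 = 0")
    case True
    have "card J < card B" using insert by simp
    from insert.IH[OF \<open>finite B\<close> this, of v] True show ?thesis by auto
  next
    case False
    then obtain b0 where b0: "b0 \<in> B" "v b0 j0 \<noteq> 0" by auto
    let ?B = "B - {b0}"
    let ?w = "\<lambda>b j. v b j - (v b j0 / v b0 j0) * v b0 j"
    \<comment> \<open>The \<open>j0\<close>-th entry of every \<open>?w b\<close> is zero, and the value of \<open>a\<close> at \<open>b0\<close> is forced by the
      \<open>j0\<close>-th equation.\<close>
    have "finite ?B" "card J < card ?B" using insert b0 by auto
    from insert.IH[OF this, of ?w] obtain a where
      a: "\<exists>b\<in>?B. a b \<noteq> 0" "\<forall>j\<in>J. (\<Sum>b\<in>?B. a b * ?w b j) = 0" by auto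
    define s where "s = (\<Sum>b\<in>?B. a b * v b j0) / v b0 j0"
    let ?a = "\<lambda>b. if b = b0 then - s else a b"
    have "(\<Sum>b\<in>B. ?a b * v b j) = (\<Sum>b\<in>?B. a b * ?w b j)" for j
    proof -
      have "(\<Sum>b\<in>B. ?a b * v b j) = - s * v b0 j + (\<Sum>b\<in>?B. ?a b * v b j)"
        using b0 \<open>finite B\<close> by (simp add: sum.remove)
      also have "(\<Sum>b\<in>?B. ?a b * v b j) = (\<Sum>b\<in>?B. a b * v b j)"
        by (rule sum.cong) auto
      also have "- s * v b0 j + \<dots> = (\<Sum>b\<in>?B. a b * ?w b j)"
        by (simp add: s_def algebra_simps sum_subtractf sum_distrib_left sum_distrib_right
            sum_divide_distrib)
      finally show ?thesis .
    qed
    moreover have "(\<Sum>b\<in>?B. a b * ?w b j0) = 0" using b0 by simp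
    moreover have "\<exists>b\<in>B. ?a b \<noteq> 0" using a(1) by (auto intro!: bexI)
    ultimately show ?thesis using a(2) by (intro exI[of _ ?a]) auto
  qed
qed

section \<open>Upper bound: decompositions through a given point\<close>

lemma sum_powers_root_of_unity:
  assumes "N > 0"
  obtains \<omega> :: complex where
    "\<And>t. (\<Sum>s<N. (\<omega> ^ s) ^ t) = (if N dvd t then of_nat N else 0)"
proof
  fix t
  let ?w = "cis (2 * pi / real N)"
  have 1: "?w ^ N = 1" using assms by (simp add: DeMoivre)
  have 2: "N dvd t" if "?w ^ t = 1"
  proof -
    have "?w ^ (t mod N) = ?w ^ (N * (t div N) + t mod N)"
      unfolding power_add power_mult 1 by simp
    also have "\<dots> = 1" using that by simp
    finally have eq: "?w ^ (t mod N) = 1" .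
    have "cis (2 * pi * real (t mod N) / real N) = cis (2 * pi * real 0 / real N)"
      using eq by (simp add: DeMoivre mult_ac)
    from inj_onD[OF bij_betw_imp_inj_on[OF bij_betw_roots_unity[OF assms]] this] assms
    show ?thesis by (auto simp: dvd_eq_mod_eq_0)
  qed
  have comm: "(\<Sum>s<N. (?w ^ s) ^ t) = (\<Sum>s<N. (?w ^ t) ^ s)"
    by (simp add: mult.commute flip: power_mult)
  show "(\<Sum>s<N. (?w ^ s) ^ t) = (if N dvd t then of_nat N else 0)"
  proof (cases "N dvd t")
    case True
    then have "?w ^ t = 1" using 1 by (auto elim!: dvdE simp: power_mult)
    then show ?thesis using True by (simp add: comm)
  next
    case False
    then have "?w ^ t \<noteq> 1" using 2 by auto
    moreover have "(?w ^ t) ^ N = 1" using 1 by (metis mult.commute power_mult power_one)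
    ultimately show ?thesis using False by (simp add: comm geometric_sum)
  qed
qed

lemma dvd_less_double_eq:
  fixes N t :: nat
  assumes "N dvd t" "0 < t" "t < 2 * N"
  shows "t = N"
proof -
  from assms(1) obtain m where m: "t = N * m" by (auto elim: dvdE)
  with assms(2,3) have "m < 2" "m \<noteq> 0" by (auto simp: mult.commute)
  then show ?thesis using m by (simp add: less_2_cases_iff)
qed

text \<open>
  On polynomials of degree at most $e + e_0$ in one variable, taking the coefficient of $y^e$ is a
  combination of evaluations at $e+1$ points, one of which is \<open>z\<close>. For $z \neq 0$ the points are
  $z\omega^s$ with $\omega$ a primitive root of unity of order $e+1$: the weights
  $\omega^s/((e+1)z^e)$ single out the exponents \<open>t\<close> with $e+1 \mid t+1$, and the first one after
  \<open>e\<close> is $2e+1 > e+e_0$. For $z = 0$ they are \<open>0\<close> and the roots of unity of order \<open>e\<close>: these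
  single out the multiples of \<open>e\<close>, the point \<open>0\<close> with weight $-1$ corrects $t = 0$, and the
  next multiple $2e$ is out of range only if $e_0 < e$. This is where points with a vanishing
  coordinate of non-minimal exponent are allowed.
\<close>

lemma one_variable_functional_through_point:
  fixes z :: complex
  assumes "e0 \<le> e" "z \<noteq> 0 \<or> e0 < e"
  obtains u w where "u 0 = z" "(\<Sum>s\<le>e. w s * u s ^ e) = 1"
    "\<forall>t. t \<noteq> e \<and> t \<le> e + e0 \<longrightarrow> (\<Sum>s\<le>e. w s * u s ^ t) = 0"
proof (cases "z = 0")
  case False
  obtain \<omega> :: complex where
    \<omega>: "\<And>t. (\<Sum>s<Suc e. (\<omega> ^ s) ^ t) = (if Suc e dvd t then of_nat (Suc e) else 0)"
    using sum_powers_root_of_unity[of "Suc e"] by blast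
  let ?u = "\<lambda>s. z * \<omega> ^ s" and ?w = "\<lambda>s. \<omega> ^ s / (of_nat (Suc e) * z ^ e)"
  have eq: "(\<Sum>s\<le>e. ?w s * ?u s ^ t) = (if Suc e dvd Suc t then z ^ t / z ^ e else 0)" for t
  proof -
    have "(\<Sum>s\<le>e. ?w s * ?u s ^ t) =
        z ^ t / (of_nat (Suc e) * z ^ e) * (\<Sum>s<Suc e. (\<omega> ^ s) ^ Suc t)"
      by (simp add: sum_distrib_left lessThan_Suc_atMost power_mult_distrib field_simps
          del: sum.lessThan_Suc of_nat_Suc)
    then show ?thesis unfolding \<omega> by (simp del: of_nat_Suc)
  qed
  show ?thesis
  proof (rule that[of ?u ?w])
    show "(\<Sum>s\<le>e. ?w s * ?u s ^ e) = 1" using False by (simp only: eq) simp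
    have "\<not> Suc e dvd Suc t" if "t \<noteq> e" "t \<le> e + e0" for t
      using dvd_less_double_eq[of "Suc e" "Suc t"] that assms(1) by auto
    then show "\<forall>t. t \<noteq> e \<and> t \<le> e + e0 \<longrightarrow> (\<Sum>s\<le>e. ?w s * ?u s ^ t) = 0"
      by (simp only: eq) simp
  qed simp
next
  case True
  then have e: "e > 0" "e0 < e" using assms by auto
  obtain \<omega> :: complex where
    \<omega>: "\<And>t. (\<Sum>s<e. (\<omega> ^ s) ^ t) = (if e dvd t then of_nat e else 0)"
    using sum_powers_root_of_unity[of e] e by blast
  let ?u = "\<lambda>s. case s of 0 \<Rightarrow> 0 | Suc r \<Rightarrow> \<omega> ^ r"
  let ?w = "\<lambda>s. case s of 0 \<Rightarrow> -1 | Suc r \<Rightarrow> 1 / of_nat e"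
  have eq: "(\<Sum>s\<le>e. ?w s * ?u s ^ t) = (if e dvd t \<and> t > 0 then 1 else 0)" for t
  proof -
    have "(\<Sum>s\<le>e. ?w s * ?u s ^ t) = - (0 ^ t) + 1 / of_nat e * (\<Sum>s<e. (\<omega> ^ s) ^ t)"
      by (simp add: sum.atMost_shift sum_distrib_left)
    then show ?thesis using e by (auto simp: \<omega> power_0_left)
  qed
  show ?thesis
  proof (rule that[of ?u ?w])
    show "?u 0 = z" using True by simp
    show "(\<Sum>s\<le>e. ?w s * ?u s ^ e) = 1" using e by (simp only: eq) simp
    have "\<not> (e dvd t \<and> t > 0)" if "t \<noteq> e" "t \<le> e + e0" for t
      using dvd_less_double_eq[of e t] that e by auto
    then show "\<forall>t. t \<noteq> e \<and> t \<le> e + e0 \<longrightarrow> (\<Sum>s\<le>e. ?w s * ?u s ^ t) = 0"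
      unfolding eq by (metis (no_types, lifting))
  qed
qed

text \<open>
  Let $\Lambda = \sum_t c_t\,\mathrm{ev}_{P_t}$ be the functional of a power sum
  decomposition of \<open>F\<close>. On monomials divisible by $x_i$ it sees only the points with
  $p_i \neq 0$, so these points can be treated as points of the affine chart $x_i = 1$, and there
  $\Lambda$ is defined on polynomials of degree at most $d-1$ in the remaining variables; by the
  multinomial theorem the only monomial that it does not kill is $y^e$, of degree $d - e_i$.
  The monomials $y^b$ with $b \le e$ are linearly independent as functions on these points: given a
  relation $g = \sum_b a_b y^b = 0$, let $y^m$ be a monomial of maximal degree in $g$. Then
  $y^{e-m} g$ still has degree at most $d - e_i \le d-1$, and among its monomials exactly
  $y^{e-m}y^m$ is $y^e$, so $0 = \Lambda(y^{e-m}g)$ is a nonzero multiple of $a_m$. Hence there are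
  at least as many points as such exponents \<open>b\<close>.

  This replaces the comparison of the Hilbert functions of the ideal of the points and of
  the apolar ideal of \<open>F\<close>.
\<close>

lemma points_off_hyperplane_lower_bound:
  assumes i: "i \<le> n" "1 \<le> e i" and d: "d = (\<Sum>k\<le>n. e k)"
    and T: "finite T"
    and F: "Poly_Mapping.single (expo n e) 1 = (\<Sum>t\<in>T. cscale (c t) (lform n (P t) ^ d))"
  shows "(\<Prod>k\<in>{..n} - {i}. Suc (e k)) \<le> card {t \<in> T. P t i \<noteq> 0}"
proof (rule ccontr)
  define K where "K = {..n} - {i}"
  define B where "B = (\<Pi>\<^sub>E k\<in>K. {..e k})"
  define J where "J = {t \<in> T. P t i \<noteq> 0}"
  have K: "finite K" "i \<notin> K" and ins: "{..n} = insert i K" using i by (auto simp: K_def)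
  have B: "finite B" "card B = (\<Prod>k\<in>K. Suc (e k))"
    by (auto simp: B_def K card_PiE intro: finite_PiE)
  let ?v = "\<lambda>b t. \<Prod>k\<in>K. (P t k / P t i) ^ b k"
  let ?deg = "\<lambda>b. \<Sum>k\<in>K. b k"
  assume "\<not> ?thesis"
  then have "card J < card B" unfolding B(2) by (simp add: J_def K_def)
  moreover have "finite J" using T by (simp add: J_def)
  ultimately obtain a where
    a: "\<exists>b\<in>B. a b \<noteq> 0" "\<forall>t\<in>J. (\<Sum>b\<in>B. a b * ?v b t) = 0"
    using homogeneous_system_nontrivial_solution[of J B ?v] B(1) by blast
  define B' where "B' = {b \<in> B. a b \<noteq> 0}"
  have B': "finite B'" "B' \<noteq> {}" using B(1) a(1) by (auto simp: B'_def)
  obtain m where m: "m \<in> B'" "\<And>b. b \<in> B' \<Longrightarrow> ?deg b \<le> ?deg m"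
  proof -
    have "Max (?deg ` B') \<in> ?deg ` B'" using B' by (intro Max_in) auto
    then obtain m where "m \<in> B'" "?deg m = Max (?deg ` B')" by auto
    then show ?thesis using B' by (intro that[of m]) auto
  qed
  have a0: "a m \<noteq> 0" and mB: "m \<in> B" using m by (auto simp: B'_def)
  have me: "m k \<le> e k" if "k \<in> K" for k using mB that by (auto simp: B_def)
  \<comment> \<open>The exponent vector of $y^{e-m}y^b$, homogenized with $x_i$ to degree \<open>d\<close>. The exponent of
    $x_i$ is positive because $e_i \ge 1$ and $\deg b \le \deg m$, and \<open>\<alpha> m\<close> is \<open>e\<close>.\<close>
  define \<alpha> where "\<alpha> = (\<lambda>b k. if k = i then e i + ?deg m - ?deg b else e k - m k + b k)"
  have pos: "\<alpha> b i \<noteq> 0" if "b \<in> B'" for b using m(2)[OF that] i by (simp add: \<alpha>_def)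
  have sumK: "(\<Sum>k\<in>K. \<alpha> b k) + ?deg m = (\<Sum>k\<in>K. e k) + ?deg b" for b
  proof -
    have "(\<Sum>k\<in>K. \<alpha> b k) + ?deg m = (\<Sum>k\<in>K. \<alpha> b k + m k)" by (simp add: sum.distrib)
    also have "\<dots> = (\<Sum>k\<in>K. e k + b k)"
    proof (rule sum.cong[OF refl])
      show "\<alpha> b k + m k = e k + b k" if "k \<in> K" for k
        using me[OF that] that K(2) by (auto simp: \<alpha>_def)
    qed
    finally show ?thesis by (simp add: sum.distrib)
  qed
  have deg: "(\<Sum>k\<le>n. \<alpha> b k) = d" if "b \<in> B'" for b
    using sumK[of b] m(2)[OF that] K by (simp add: d ins \<alpha>_def)
  let ?\<kappa> = "1 / multinom n (expo n e)"
  have coeff: "(\<Sum>t\<in>T. c t * (\<Prod>k\<le>n. P t k ^ \<alpha> b k)) = (if b = m then ?\<kappa> else 0)"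
    if b: "b \<in> B'" for b
  proof -
    have bm: "expo n e = expo n (\<alpha> b) \<longleftrightarrow> b = m"
    proof
      assume "expo n e = expo n (\<alpha> b)"
      then have eq: "e k = \<alpha> b k" if "k \<le> n" for k using that by (simp add: expo_eq_iff)
      have "b k = m k" if "k \<in> K" for k
        using eq[of k] me[OF that] that by (auto simp: \<alpha>_def K_def split: if_splits)
      then show "b = m" using b mB unfolding B_def B'_def by (auto intro: PiE_ext)
    next
      assume "b = m"
      then show "expo n e = expo n (\<alpha> b)" using me by (auto simp: expo_eq_iff \<alpha>_def K_def)
    qed
    have "(1 when expo n e = expo n (\<alpha> b)) =
        multinom n (expo n (\<alpha> b)) * (\<Sum>t\<in>T. c t * (\<Prod>k\<le>n. P t k ^ \<alpha> b k))"
      using arg_cong[OF F, of "\<lambda>f. Poly_Mapping.lookup f (expo n (\<alpha> b))"] deg[OF b]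
      by (simp add: lookup_single lookup_sum lookup_cscale lookup_lform_power_expo
          sum_distrib_left mult_ac)
    then show ?thesis
      using bm multinom_nonzero[of n "expo n e"] multinom_nonzero[of n "expo n (\<alpha> b)"]
      by (auto simp: when_def field_simps split: if_splits)
  qed
  have mono: "(\<Prod>k\<le>n. P t k ^ \<alpha> b k) =
      P t i ^ d * (\<Prod>k\<in>K. (P t k / P t i) ^ (e k - m k)) * ?v b t"
    if "t \<in> J" and b: "b \<in> B'" for t b
  proof -
    have nz: "P t i \<noteq> 0" using that by (simp add: J_def)
    have "d = \<alpha> b i + (\<Sum>k\<in>K. \<alpha> b k)" using deg[OF b] K by (simp add: ins)
    then have "P t i ^ d * (\<Prod>k\<in>K. (P t k / P t i) ^ \<alpha> b k) =
        P t i ^ \<alpha> b i * (\<Prod>k\<in>K. P t i ^ \<alpha> b k * (P t k / P t i) ^ \<alpha> b k)"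
      by (simp add: power_add power_sum prod.distrib)
    also have "\<dots> = (\<Prod>k\<le>n. P t k ^ \<alpha> b k)"
      using nz K by (simp add: ins flip: power_mult_distrib)
    finally have "(\<Prod>k\<le>n. P t k ^ \<alpha> b k) = P t i ^ d * (\<Prod>k\<in>K. (P t k / P t i) ^ \<alpha> b k)" ..
    also have "(\<Prod>k\<in>K. (P t k / P t i) ^ \<alpha> b k) =
        (\<Prod>k\<in>K. (P t k / P t i) ^ (e k - m k) * (P t k / P t i) ^ b k)"
      using K(2) by (intro prod.cong) (auto simp: \<alpha>_def power_add)
    finally show ?thesis by (simp add: prod.distrib mult.assoc)
  qed
  have off: "(\<Prod>k\<le>n. P t k ^ \<alpha> b k) = 0" if "t \<in> T - J" "b \<in> B'" for t b
    using that pos[of b] i by (auto simp: J_def intro!: bexI[of _ i])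
  have "a m * ?\<kappa> = (\<Sum>b\<in>B'. a b * (if b = m then ?\<kappa> else 0))"
    using m(1) B' by (simp add: if_distrib cong: if_cong)
  also have "\<dots> = (\<Sum>b\<in>B'. a b * (\<Sum>t\<in>T. c t * (\<Prod>k\<le>n. P t k ^ \<alpha> b k)))"
    by (simp add: coeff)
  also have "\<dots> = (\<Sum>b\<in>B'. a b * (\<Sum>t\<in>J. c t * (\<Prod>k\<le>n. P t k ^ \<alpha> b k)))"
    using T off by (intro sum.cong refl arg_cong2[where f = "(*)"] sum.mono_neutral_right)
      (auto simp: J_def)
  also have "\<dots> = (\<Sum>t\<in>J. c t * (\<Sum>b\<in>B'. a b * (\<Prod>k\<le>n. P t k ^ \<alpha> b k)))"
    by (simp add: sum_distrib_left mult_ac sum.swap[of _ J B'])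
  also have "\<dots> = (\<Sum>t\<in>J. c t * (P t i ^ d * (\<Prod>k\<in>K. (P t k / P t i) ^ (e k - m k))
      * (\<Sum>b\<in>B'. a b * ?v b t)))"
    by (simp add: mono sum_distrib_left mult_ac)
  also have "\<dots> = 0"
  proof -
    have "(\<Sum>b\<in>B'. a b * ?v b t) = (\<Sum>b\<in>B. a b * ?v b t)" for t
      using B(1) by (intro sum.mono_neutral_left) (auto simp: B'_def)
    then show ?thesis using a(2) by simp
  qed
  finally show False using a0 multinom_nonzero by simp
qed

text \<open>
  The points form a grid in the chart $x_0 = 1$, and the functional is the tensor product of the
  functionals of the previous lemma for $x_1,\dots,x_n$. On a monomial $x^a$ of degree \<open>d\<close> it is
  the product of their values at $a_1,\dots,a_n$. If no factor vanishes, then for each $k \ge 1$ either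
  $a_k = e_k$ or $a_k > e_k + e_0$; the second alternative for a single \<open>k\<close> would make the total
  degree exceed $e_0 + \dots + e_n = d$. So $a = e$, and the functional is that of \<open>F\<close>. The ideal
  of the grid is a complete intersection inside the apolar ideal of \<open>F\<close>.
\<close>

lemma monomial_power_sum_through_point:
  assumes min: "\<forall>k\<le>n. e 0 \<le> e k" and d: "d = (\<Sum>k\<le>n. e k)"
    and p: "p \<in> cvecs n" "p 0 = 1" "\<forall>k\<le>n. e k = e 0 \<longrightarrow> p k \<noteq> 0"
  obtains S :: "(nat \<Rightarrow> nat) set" and s0 Q c where
    "finite S" "card S = (\<Prod>k=1..n. Suc (e k))" "s0 \<in> S" "Q s0 = p"
    "\<forall>s\<in>S. Q s \<in> cvecs n"
    "Poly_Mapping.single (expo n e) 1 = (\<Sum>s\<in>S. cscale (c s) (lform n (Q s) ^ d))"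
proof -
  define good where "good k u w \<longleftrightarrow> u 0 = p k \<and> (\<Sum>s\<le>e k. w s * u s ^ e k) = 1 \<and>
      (\<forall>t. t \<noteq> e k \<and> t \<le> e k + e 0 \<longrightarrow> (\<Sum>s\<le>e k. w s * u s ^ t) = 0)"
    for k and u w :: "nat \<Rightarrow> complex"
  have "\<exists>u w. good k u w" if "k \<le> n" for k
  proof -
    have "e 0 \<le> e k" "p k \<noteq> 0 \<or> e 0 < e k"
      using that min p(3) by (auto simp: le_less)
    then obtain u w where "u 0 = p k" "(\<Sum>s\<le>e k. w s * u s ^ e k) = 1"
      "\<forall>t. t \<noteq> e k \<and> t \<le> e k + e 0 \<longrightarrow> (\<Sum>s\<le>e k. w s * u s ^ t) = 0"
      by (rule one_variable_functional_through_point)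
    then have "good k u w" unfolding good_def by blast
    then show ?thesis by blast
  qed
  then obtain u w where "\<And>k. k \<le> n \<Longrightarrow> good k (u k) (w k)" by metis
  then have u0: "u k 0 = p k" and fe: "(\<Sum>s\<le>e k. w k s * u k s ^ e k) = 1"
    and f0: "t \<noteq> e k \<Longrightarrow> t \<le> e k + e 0 \<Longrightarrow> (\<Sum>s\<le>e k. w k s * u k s ^ t) = 0"
    if "k \<le> n" for k t
    using that unfolding good_def by blast+
  define S where "S = (\<Pi>\<^sub>E k\<in>{1..n}. {..e k})"
  define s0 where "s0 = restrict (\<lambda>_. 0::nat) {1..n}"
  define Q where "Q = (\<lambda>s k. if k = 0 then 1 else if k \<le> n then u k (s k) else 0)"
  define c where "c = (\<lambda>s. (\<Prod>k=1..n. w k (s k)) / multinom n (expo n e))"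
  have zero: "{..n} = insert 0 {1..n}" by auto
  show ?thesis
  proof (rule that[of S s0 Q c])
    show "finite S" unfolding S_def by (intro finite_PiE) auto
    show "card S = (\<Prod>k=1..n. Suc (e k))" by (simp add: S_def card_PiE)
    show "s0 \<in> S" by (auto simp: S_def s0_def)
    show "Q s0 = p" using p(1,2) by (auto simp: fun_eq_iff Q_def s0_def u0 cvecs_def)
    show "\<forall>s\<in>S. Q s \<in> cvecs n" by (simp add: Q_def cvecs_def)
    show "Poly_Mapping.single (expo n e) 1 = (\<Sum>s\<in>S. cscale (c s) (lform n (Q s) ^ d))"
      (is "_ = ?G")
    proof (rule poly_mapping_eqI)
      fix a
      let ?l = "Poly_Mapping.lookup"
      show "?l (Poly_Mapping.single (expo n e) 1) a = ?l ?G a"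
      proof (cases "Poly_Mapping.keys a \<subseteq> {..n} \<and> (\<Sum>k\<le>n. ?l a k) = d")
        case False
        moreover have "a \<noteq> expo n e"
        proof
          assume a: "a = expo n e"
          have "(\<Sum>k\<le>n. ?l a k) = (\<Sum>k\<le>n. e k)"
            unfolding a by (rule sum.cong) (auto simp: lookup_expo)
          then show False using False keys_expo a d by auto
        qed
        ultimately show ?thesis
          by (simp only: lookup_single lookup_sum lookup_cscale lookup_lform_power when_def
              if_not_P[OF False] if_False) simp
      next
        case True
        define \<alpha> where "\<alpha> = ?l a"
        have a: "a = expo n \<alpha>" using True by (simp add: \<alpha>_def expo_lookup)
        have deg: "(\<Sum>k\<le>n. \<alpha> k) = d" using True by (simp add: \<alpha>_def)
        have "?l ?G a = (\<Sum>s\<in>S. c s * (multinom n a * (\<Prod>k\<le>n. Q s k ^ \<alpha> k)))"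
          by (simp add: lookup_sum lookup_cscale a lookup_lform_power_expo deg)
        also have "\<dots> = multinom n a / multinom n (expo n e) *
            (\<Sum>s\<in>S. \<Prod>k=1..n. w k (s k) * u k (s k) ^ \<alpha> k)"
          by (simp add: c_def sum_distrib_left zero Q_def prod.distrib mult_ac)
        also have "(\<Sum>s\<in>S. \<Prod>k=1..n. w k (s k) * u k (s k) ^ \<alpha> k) =
            (\<Prod>k=1..n. \<Sum>s\<le>e k. w k s * u k s ^ \<alpha> k)"
          unfolding S_def by (rule prod_sum_PiE[symmetric]) auto
        also have "\<dots> = (if a = expo n e then 1 else 0)"
        proof (cases "a = expo n e")
          case True
          then have "\<alpha> k = e k" if "k \<le> n" for k using that by (simp add: a expo_eq_iff)
          then show ?thesis using True fe by simp
        next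
          case False
          have "\<exists>k\<in>{1..n}. (\<Sum>s\<le>e k. w k s * u k s ^ \<alpha> k) = 0"
          proof (rule ccontr)
            assume "\<not> ?thesis"
            then have nz: "\<alpha> k = e k \<or> e k + e 0 < \<alpha> k" if "k \<in> {1..n}" for k
              using f0[of k "\<alpha> k"] that by (metis atLeastAtMost_iff not_le)
            have sums: "\<alpha> 0 + (\<Sum>k=1..n. \<alpha> k) = e 0 + (\<Sum>k=1..n. e k)"
              using deg d by (simp add: zero)
            have "\<forall>k\<in>{1..n}. \<alpha> k = e k"
            proof (rule ccontr)
              assume "\<not> ?thesis"
              then obtain j where j: "j \<in> {1..n}" "\<alpha> j \<noteq> e j" by auto
              have "(\<Sum>k\<in>{1..n} - {j}. e k) \<le> (\<Sum>k\<in>{1..n} - {j}. \<alpha> k)"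
                using nz by (intro sum_mono) fastforce
              moreover have "e j + e 0 < \<alpha> j" using nz j by auto
              ultimately show False using sums j by (simp add: sum.remove)
            qed
            moreover from this have "\<alpha> 0 = e 0" using sums by simp
            ultimately have "\<alpha> k = e k" if "k \<le> n" for k
              using that by (cases "k = 0") auto
            then show False using False by (simp add: a expo_eq_iff)
          qed
          then show ?thesis using False by (auto simp: prod_zero_iff)
        qed
        finally show ?thesis
          using multinom_nonzero by (auto simp: lookup_single when_def)
      qed
    qed
  qed
qed

section \<open>The Waring rank and the Waring locus of a monomial\<close>

lemma complex_nth_root_exists:
  assumes "d > 0" shows "\<exists>z::complex. z ^ d = c"
proof (cases "c = 0")
  case True
  then show ?thesis using assms by (intro exI[of _ 0]) simp
next
  case False
  then have "{z. z ^ d = c} \<noteq> {}"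
    using card_nth_roots[OF False assms] assms by (metis card.empty less_irrefl)
  then show ?thesis by blast
qed

lemma lform_scale: "lform n (\<lambda>k. c * p k) = cscale c (lform n p)"
  by (simp add: lform_def cscale_def sum_distrib_left mult_single flip: mult.assoc)

lemma cscale_power: "cscale c f ^ d = cscale (c ^ d) (f ^ d)"
proof -
  have "(Poly_Mapping.single 0 c :: cpoly) ^ d = Poly_Mapping.single 0 (c ^ d)"
    by (induction d) (simp_all add: mult_single)
  then show ?thesis by (simp add: cscale_def power_mult_distrib)
qed

lemma cvecs_scale: "p \<in> cvecs n \<Longrightarrow> (\<lambda>k. c * p k) \<in> cvecs n"
  by (simp add: cvecs_def)

text \<open>
  The rank is defined by sums of powers without coefficients, so the coefficients of the
  decomposition through $[1:\dots:1]$ are absorbed into the linear forms by taking \<open>d\<close>-th roots.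
\<close>

lemma waring_rank_monomial:
  assumes e0: "1 \<le> e 0" and min: "\<forall>k\<le>n. e 0 \<le> e k" and d: "d = (\<Sum>k\<le>n. e k)"
  shows "waring_rank n d (Poly_Mapping.single (expo n e) 1) = (\<Prod>k=1..n. Suc (e k))"
proof -
  let ?F = "Poly_Mapping.single (expo n e) 1 :: cpoly"
  let ?R = "\<Prod>k=1..n. Suc (e k)"
  let ?ok = "\<lambda>r. \<exists>L. (\<forall>i\<in>{1..r}. L i \<in> linear_forms n) \<and> ?F = (\<Sum>i=1..r. L i ^ d)"
  have R: "(\<Prod>k\<in>{..n} - {0}. Suc (e k)) = ?R"
    by (rule prod.cong) auto
  have "d > 0" using e0 d by (simp add: sum.remove[of _ 0])
  have upper: "?ok ?R"
  proof -
    let ?p = "\<lambda>k. if k \<le> n then 1 else (0::complex)"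
    have "?p \<in> cvecs n" "?p 0 = 1" "\<forall>k\<le>n. e k = e 0 \<longrightarrow> ?p k \<noteq> 0"
      by (auto simp: cvecs_def)
    from this obtain S :: "(nat \<Rightarrow> nat) set" and s0 Q c where
      S: "finite S" "card S = ?R" "s0 \<in> S" "Q s0 = ?p" "\<forall>s\<in>S. Q s \<in> cvecs n"
      and F: "?F = (\<Sum>s\<in>S. cscale (c s) (lform n (Q s) ^ d))"
      by (rule monomial_power_sum_through_point[OF min d])
    obtain h where h: "bij_betw h {1..?R} S"
      using ex_bij_betw_nat_finite_1[OF S(1)] S(2) by auto
    have "\<forall>s. \<exists>z. z ^ d = c s" using complex_nth_root_exists[OF \<open>d > 0\<close>] by blast
    from choice[OF this] obtain z where z: "\<And>s. z s ^ d = c s" by blast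
    let ?L = "\<lambda>i. lform n (\<lambda>k. z (h i) * Q (h i) k)"
    have "?F = (\<Sum>i=1..?R. cscale (c (h i)) (lform n (Q (h i)) ^ d))"
      unfolding F
      by (rule sum.reindex_bij_betw[OF h, of "\<lambda>s. cscale (c s) (lform n (Q s) ^ d)", symmetric])
    also have "\<dots> = (\<Sum>i=1..?R. ?L i ^ d)"
      by (simp add: lform_scale cscale_power z)
    finally have "?F = (\<Sum>i=1..?R. ?L i ^ d)" .
    moreover have "\<forall>i\<in>{1..?R}. ?L i \<in> linear_forms n"
      using bij_betw_apply[OF h] S(5) by (auto simp: linear_forms_def intro!: imageI cvecs_scale)
    ultimately show ?thesis by (intro exI[of _ ?L]) auto
  qed
  have lower: "?R \<le> r" if "?ok r" for r
  proof -
    from that obtain L where L: "\<forall>i\<in>{1..r}. L i \<in> linear_forms n" "?F = (\<Sum>i=1..r. L i ^ d)"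
      by auto
    from L(1) have "\<forall>i\<in>{1..r}. \<exists>q. L i = lform n q" by (auto simp: linear_forms_def)
    then obtain q where q: "\<And>i. i \<in> {1..r} \<Longrightarrow> L i = lform n (q i)" by metis
    have "?F = (\<Sum>i=1..r. cscale 1 (lform n (q i) ^ d))"
      using L(2) q by simp
    from points_off_hyperplane_lower_bound[OF _ e0 d _ this]
    have "?R \<le> card {i \<in> {1..r}. q i 0 \<noteq> 0}" by (simp add: R)
    also have "\<dots> \<le> card {1..r}" by (intro card_mono) auto
    finally show ?thesis by simp
  qed
  show ?thesis
    unfolding waring_rank_def
  proof (rule Least_equality)
    show "?ok ?R" by (rule upper)
  qed (rule lower)
qed

lemma proj_pt_scale:
  assumes "c \<noteq> 0" shows "proj_pt (\<lambda>k. c * p k) = proj_pt p"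
proof -
  have "(\<lambda>k. b * (c * p k)) \<in> proj_pt p" if "b \<noteq> 0" for b
    using assms that by (auto simp: proj_pt_def intro!: exI[of _ "b * c"])
  moreover have "(\<lambda>k. b * p k) \<in> proj_pt (\<lambda>k. c * p k)" if "b \<noteq> 0" for b
    using assms that by (auto simp: proj_pt_def intro!: exI[of _ "b / c"])
  ultimately show ?thesis by (auto simp: proj_pt_def)
qed

lemma proj_pt_self: "p \<in> proj_pt p"
  by (auto simp: proj_pt_def intro!: exI[of _ 1])

lemma proj_pt_eqD:
  assumes "proj_pt p = proj_pt q" obtains c where "c \<noteq> 0" "p = (\<lambda>k. c * q k)"
  using proj_pt_self[of p] assms by (auto simp: proj_pt_def)

text \<open>
  If the coordinates of minimal exponent do not vanish, the grid through the point is a minimal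
  decomposition. Conversely, suppose that $[q]$ occurs in a span of as many powers as the rank
  and that $q_i = 0$ with $e_i = e_0$. Since \<open>i\<close> has minimal exponent, the lower bound for the number
  of points off $x_i = 0$ already equals the rank, and $[q]$ itself is one more point.
\<close>

lemma waring_locus_monomial:
  assumes e0: "1 \<le> e 0" and min: "\<forall>k\<le>n. e 0 \<le> e k" and d: "d = (\<Sum>k\<le>n. e k)"
    and p: "p \<in> cvecs n" "p \<noteq> (\<lambda>_. 0)"
  shows "proj_pt p \<in> waring_locus n d (Poly_Mapping.single (expo n e) 1) \<longleftrightarrow>
    (\<forall>i\<le>n. e i = e 0 \<longrightarrow> p i \<noteq> 0)"
    (is "_ \<in> waring_locus n d ?F \<longleftrightarrow> ?nz p")
proof
  let ?R = "\<Prod>k=1..n. Suc (e k)"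
  have rank: "waring_rank n d ?F = ?R"
    using waring_rank_monomial[of e n, OF e0 min d] .
  assume nz: "?nz p"
  define q where "q = (\<lambda>k. (1 / p 0) * p k)"
  have p0: "p 0 \<noteq> 0" using nz by simp
  have q: "q \<in> cvecs n" "q 0 = 1" "\<forall>k\<le>n. e k = e 0 \<longrightarrow> q k \<noteq> 0"
    using p0 nz cvecs_scale[OF p(1), of "1 / p 0"] by (simp_all add: q_def)
  have pq: "proj_pt p = proj_pt q" using p0 unfolding q_def by (intro proj_pt_scale[symmetric]) simp
  obtain S :: "(nat \<Rightarrow> nat) set" and s0 Q c where
    S: "finite S" "card S = ?R" "s0 \<in> S" "Q s0 = q" "\<forall>s\<in>S. Q s \<in> cvecs n"
    and F: "?F = (\<Sum>s\<in>S. cscale (c s) (lform n (Q s) ^ d))"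
    by (rule monomial_power_sum_through_point[OF min d q])
  obtain h where h: "bij_betw h {2..?R} (S - {s0})"
    using finite_same_card_bij[of "{2..?R}" "S - {s0}"] S by auto
  let ?L = "\<lambda>i. lform n (Q (h i))"
  let ?V = "insert (lform n q ^ d) ((\<lambda>i. ?L i ^ d) ` {2..?R})"
  have "lform n (Q s) ^ d \<in> ?V" if "s \<in> S" for s
  proof (cases "s = s0")
    case False
    then have "s \<in> h ` {2..?R}" using that h by (simp add: bij_betw_def)
    then show ?thesis by blast
  qed (use S in simp)
  then have "?F \<in> cpoly.span ?V"
    unfolding F by (intro cpoly.span_sum cpoly.span_scale cpoly.span_base)
  moreover have "\<forall>i\<in>{2..?R}. ?L i \<in> linear_forms n"
    using bij_betw_apply[OF h] S(5) by (auto simp: linear_forms_def)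
  moreover have "q \<noteq> (\<lambda>_. 0)" using q(2) by auto
  ultimately show "proj_pt p \<in> waring_locus n d ?F"
    unfolding waring_locus_def rank pq using q(1) by (auto intro!: exI[of _ q] exI[of _ ?L])
next
  let ?R = "\<Prod>k=1..n. Suc (e k)"
  have rank: "waring_rank n d ?F = ?R"
    using waring_rank_monomial[of e n, OF e0 min d] .
  assume "proj_pt p \<in> waring_locus n d ?F"
  then obtain q L where pq: "proj_pt p = proj_pt q" and L: "\<forall>i\<in>{2..?R}. L i \<in> linear_forms n"
    and F: "?F \<in> cpoly.span (insert (lform n q ^ d) ((\<lambda>i. L i ^ d) ` {2..?R}))"
    unfolding waring_locus_def rank by auto
  define T where "T = insert (lform n q ^ d) ((\<lambda>i. L i ^ d) ` {2..?R})"
  have T: "finite T" by (simp add: T_def)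
  have Lb: "\<exists>b. L i = lform n b" if "i \<in> {2..?R}" for i
    using L that unfolding linear_forms_def by blast
  have "\<exists>b. v = lform n b ^ d" if "v \<in> T" for v
  proof (cases "v = lform n q ^ d")
    case False
    then have "v \<in> (\<lambda>i. L i ^ d) ` {2..?R}" using that by (simp add: T_def)
    then obtain i where "v = L i ^ d" "i \<in> {2..?R}" by (rule imageE)
    then show ?thesis using Lb[of i] by auto
  qed blast
  then obtain P' where P': "\<And>v. v \<in> T \<Longrightarrow> v = lform n (P' v) ^ d" by metis
  \<comment> \<open>Several linear forms have the same power; for the power of the given form that form itself is
    chosen, in order that \<open>q\<close> is among the points of the decomposition.\<close>
  define P where "P = P'(lform n q ^ d := q)"
  have P: "v = lform n (P v) ^ d" if "v \<in> T" for v using P'[OF that] by (simp add: P_def)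
  obtain c where "?F = (\<Sum>v\<in>T. cscale (c v) v)"
    using F cpoly.span_finite[OF T] by (auto simp: T_def)
  also have "\<dots> = (\<Sum>v\<in>T. cscale (c v) (lform n (P v) ^ d))"
    using P by (intro sum.cong) auto
  finally have F: "?F = (\<Sum>v\<in>T. cscale (c v) (lform n (P v) ^ d))" .
  have cardT: "card T \<le> ?R"
  proof -
    have "card T \<le> Suc (card ((\<lambda>i. L i ^ d) ` {2..?R}))"
      unfolding T_def by (rule card_insert_le_m1) auto
    also have "\<dots> \<le> Suc (card {2..?R})"
      using card_image_le[of "{2..?R}" "\<lambda>i. L i ^ d"] by (simp only: finite_atLeastAtMost Suc_le_mono)
    also have "\<dots> = ?R" using prod_pos[of "{1..n}" "\<lambda>k. Suc (e k)"] by simp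
    finally show ?thesis .
  qed
  have "q i \<noteq> 0" if i: "i \<le> n" "e i = e 0" for i
  proof
    assume q0: "q i = 0"
    have "1 \<le> e i" using e0 i by simp
    have "?R * Suc (e 0) = (\<Prod>k\<le>n. Suc (e k))"
      by (simp add: atMost_atLeast0 prod.atLeast_Suc_atMost)
    also have "\<dots> = (\<Prod>k\<in>{..n} - {i}. Suc (e k)) * Suc (e 0)"
      using i by (simp add: prod.remove[of "{..n}" i])
    finally have "?R = (\<Prod>k\<in>{..n} - {i}. Suc (e k))"
      by (subst (asm) mult_cancel2) simp
    also have "\<dots> \<le> card {v \<in> T. P v i \<noteq> 0}"
      by (rule points_off_hyperplane_lower_bound[OF i(1) \<open>1 \<le> e i\<close> d T F])
    also have "\<dots> < card T"
      using T q0 by (intro psubset_card_mono) (auto simp: T_def P_def)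
    finally show False using cardT by simp
  qed
  moreover obtain a where "a \<noteq> 0" "p = (\<lambda>k. a * q k)" using proj_pt_eqD[OF pq] .
  ultimately show "?nz p" by auto
qed

section \<open>Eigenpoints of a monomial\<close>

lemma ceval_minor:
  "ceval p (cpderiv i (Poly_Mapping.single E 1) * cX j - cpderiv j (Poly_Mapping.single E 1) * cX i) =
    of_nat (Poly_Mapping.lookup E i) * (monval p (E - Poly_Mapping.single i 1) * p j) -
    of_nat (Poly_Mapping.lookup E j) * (monval p (E - Poly_Mapping.single j 1) * p i)"
  by (simp add: cpderiv_def cX_def mult_single ceval_diff ceval_single monval_add monval_single)

text \<open>
  The \<open>i\<close>-th partial derivative of the monomial at \<open>p\<close>. For \<open>e i = 0\<close> the truncated subtraction is
  hidden by the factor \<open>0\<close>.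
\<close>

definition grad_monomial :: "nat \<Rightarrow> (nat \<Rightarrow> nat) \<Rightarrow> (nat \<Rightarrow> complex) \<Rightarrow> nat \<Rightarrow> complex" where
  "grad_monomial n e p i = of_nat (e i) * monval p (expo n e - Poly_Mapping.single i 1)"

lemma eigenscheme_monomial_iff:
  assumes p: "p \<in> cvecs n" "p \<noteq> (\<lambda>_. 0)"
  shows "proj_pt p \<in> eigenscheme n (Poly_Mapping.single (expo n e) 1) \<longleftrightarrow>
    (\<forall>q\<in>proj_pt p. \<forall>i\<le>n. \<forall>j\<le>n. grad_monomial n e q i * q j = grad_monomial n e q j * q i)"
    (is "?L \<longleftrightarrow> ?R")
proof -
  have "proj_pt p \<in> proj_space n" using p by (simp add: proj_space_def)
  moreover have "(\<forall>f\<in>eig_minors n F. ceval q f = 0) \<longleftrightarrow> (\<forall>i j. i < j \<longrightarrow> j \<le> n \<longrightarrow>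
      ceval q (cpderiv i F * cX j - cpderiv j F * cX i) = 0)" for F q
    unfolding eig_minors_def by blast
  ultimately have "?L \<longleftrightarrow> (\<forall>q\<in>proj_pt p. \<forall>i j. i < j \<longrightarrow> j \<le> n \<longrightarrow>
      grad_monomial n e q i * q j = grad_monomial n e q j * q i)"
    by (simp add: eigenscheme_def proj_zeros_def ceval_minor grad_monomial_def
        lookup_expo mult.assoc)
  also have "\<dots> \<longleftrightarrow> ?R"
    by (metis less_imp_le_nat linorder_neqE_nat order.trans)
  finally show ?thesis .
qed

lemma monval_remove_pos:
  assumes "i \<le> n" "1 \<le> e i"
  shows "monval p (expo n e) = p i * monval p (expo n e - Poly_Mapping.single i 1)"
proof -
  have "expo n e = Poly_Mapping.single i 1 + (expo n e - Poly_Mapping.single i 1)"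
    using assms by (intro poly_mapping_eqI)
      (auto simp: lookup_add lookup_minus lookup_single lookup_expo when_def)
  then show ?thesis by (metis monval_add monval_single power_one_right)
qed

text \<open>
  The hypothesis says that the monomial, with one factor $x_k$ removed, still contains a
  variable vanishing at \<open>p\<close>. It covers the two cases needed: one vanishing coordinate with exponent
  at least two, and two vanishing coordinates.
\<close>

lemma gradient_vanishes_imp_eigenscheme:
  assumes p: "p \<in> cvecs n" "p \<noteq> (\<lambda>_. 0)"
    and van: "\<forall>k\<le>n. \<exists>i\<le>n. p i = 0 \<and> (if i = k then 2 else 1) \<le> e i"
  shows "proj_pt p \<in> eigenscheme n (Poly_Mapping.single (expo n e) 1)"
proof -
  have "grad_monomial n e q k = 0" if q: "q \<in> proj_pt p" and k: "k \<le> n" for q k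
  proof -
    from van k obtain i where i: "i \<le> n" "p i = 0" "(if i = k then 2 else 1) \<le> e i" by blast
    have "q i = 0" using q i(2) by (auto simp: proj_pt_def)
    moreover have "Poly_Mapping.lookup (expo n e - Poly_Mapping.single k 1) i > 0"
      using i(1,3) by (simp add: lookup_minus lookup_expo lookup_single when_def split: if_splits)
    ultimately have "monval q (expo n e - Poly_Mapping.single k 1) = 0"
      unfolding monval_eq_0_iff by blast
    then show ?thesis by (simp add: grad_monomial_def)
  qed
  then show ?thesis by (simp add: eigenscheme_monomial_iff[OF p])
qed

text \<open>
  At such a point only the \<open>i\<close>-th partial derivative is nonzero, whereas $p_i = 0$, so the gradient
  is not proportional to \<open>p\<close>.
\<close>

lemma single_zero_not_in_eigenscheme:
  assumes p: "p \<in> cvecs n" and i: "i \<le> n" "e i = 1" "p i = 0"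
    and nz: "\<forall>k\<le>n. k \<noteq> i \<longrightarrow> p k \<noteq> 0" and j: "j \<le> n" "j \<noteq> i"
  shows "proj_pt p \<notin> eigenscheme n (Poly_Mapping.single (expo n e) 1)"
proof
  assume eig: "proj_pt p \<in> eigenscheme n (Poly_Mapping.single (expo n e) 1)"
  have pj: "p j \<noteq> 0" using nz j by blast
  then have p0: "p \<noteq> (\<lambda>_. 0)" by auto
  from eig have "grad_monomial n e p i * p j = grad_monomial n e p j * p i"
    unfolding eigenscheme_monomial_iff[OF p p0] using proj_pt_self i(1) j(1) by blast
  then have "monval p (expo n e - Poly_Mapping.single i 1) = 0"
    using pj i by (simp add: grad_monomial_def)
  then obtain k where "p k = 0" "Poly_Mapping.lookup (expo n e - Poly_Mapping.single i 1) k > 0"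
    unfolding monval_eq_0_iff by blast
  then show False
    using nz i by (auto simp: lookup_minus lookup_expo lookup_single when_def split: if_splits)
qed

text \<open>
  With all coordinates nonzero the eigenvector equation is $e_i F/x_i = \lambda x_i$, that is,
  $x_i^2$ is proportional to $e_i$.
\<close>

lemma critical_point_in_eigenscheme:
  assumes p: "p \<in> cvecs n" "p \<noteq> (\<lambda>_. 0)" and e: "\<forall>k\<le>n. 1 \<le> e k"
    and sq: "\<forall>k\<le>n. p k ^ 2 = of_nat (e k)"
  shows "proj_pt p \<in> eigenscheme n (Poly_Mapping.single (expo n e) 1)"
  unfolding eigenscheme_monomial_iff[OF p]
proof (intro ballI allI impI)
  fix q i j assume q: "q \<in> proj_pt p" and ij: "i \<le> n" "j \<le> n"
  obtain c where c: "c \<noteq> 0" "q = (\<lambda>k. c * p k)" using q by (auto simp: proj_pt_def)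
  have grad: "c ^ 2 * grad_monomial n e q k = q k * monval q (expo n e)" if "k \<le> n" for k
  proof -
    have "c ^ 2 * of_nat (e k) = q k * q k"
      using sq that by (simp add: c(2) power2_eq_square algebra_simps)
    moreover have "monval q (expo n e) = q k * monval q (expo n e - Poly_Mapping.single k 1)"
      using that e by (intro monval_remove_pos) auto
    ultimately show ?thesis unfolding grad_monomial_def by (simp add: mult.assoc[symmetric])
  qed
  have "c ^ 2 * (grad_monomial n e q i * q j) = c ^ 2 * (grad_monomial n e q j * q i)"
    using grad[OF ij(1)] grad[OF ij(2)] by (simp flip: mult.assoc)
  then show "grad_monomial n e q i * q j = grad_monomial n e q j * q i"
    using c(1) by simp
qed

lemma proj_zeros_coordinates:
  assumes p: "p \<in> cvecs n" "p \<noteq> (\<lambda>_. 0)"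
  shows "proj_pt p \<in> proj_zeros n {cX i, cX j} \<longleftrightarrow> p i = 0 \<and> p j = 0"
proof -
  have "proj_pt p \<in> proj_space n" using p by (simp add: proj_space_def)
  moreover have "(\<forall>q\<in>proj_pt p. q i = 0 \<and> q j = 0) \<longleftrightarrow> p i = 0 \<and> p j = 0"
    using proj_pt_self[of p] by (auto simp: proj_pt_def)
  ultimately show ?thesis by (auto simp: proj_zeros_def ceval_cX)
qed

section \<open>Eigenpoints and the forbidden locus\<close>

theorem theorem3p16:
  fixes n m :: nat and e :: "nat \<Rightarrow> nat" and d :: nat and F :: cpoly
  assumes "n \<ge> 2"
    and "1 \<le> e 0"
    and "mono_on {0..n} e"
    and "m = Max {i. i \<le> n \<and> e 0 = e i}"
    and "d = (\<Sum>i=0..n. e i)"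
    and "F = (\<Prod>i=0..n. cX i ^ e i)"
  shows "(e 0 \<ge> 2 \<longrightarrow> forbidden_locus n d F \<subset> eigenscheme n F) \<and>
    (\<not> e 0 \<ge> 2 \<longrightarrow> eigenscheme n F \<inter> forbidden_locus n d F =
       (\<Union>i\<in>{0..m}. \<Union>j\<in>{0..n} - {i}. proj_zeros n {cX i, cX j})) \<and>
    eigenscheme n F \<inter> waring_locus n d F \<noteq> {}"
proof -
  have min: "\<forall>k\<le>n. e 0 \<le> e k"
    using assms(3) by (auto simp: mono_on_def)
  then have e1: "\<forall>k\<le>n. 1 \<le> e k" using assms(2) order.trans by blast
  have d: "d = (\<Sum>k\<le>n. e k)" by (simp add: assms(5) atLeast0AtMost)
  have F: "F = Poly_Mapping.single (expo n e) 1" by (simp add: assms(6) monomial_eq_single)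
  let ?A = "{i. i \<le> n \<and> e 0 = e i}"
  have m: "m \<in> ?A" unfolding assms(4) by (rule Max_in) auto
  have minimal_iff: "i \<le> m \<longleftrightarrow> i \<le> n \<and> e i = e 0" for i
  proof
    assume "i \<le> m"
    moreover from this m have "e i \<le> e m" by (intro mono_onD[OF assms(3)]) auto
    ultimately show "i \<le> n \<and> e i = e 0" using m min by (auto intro: antisym)
  next
    assume "i \<le> n \<and> e i = e 0"
    then show "i \<le> m" unfolding assms(4) by (intro Max_ge) auto
  qed
  have point: "\<exists>p. p \<in> cvecs n \<and> p \<noteq> (\<lambda>_. 0) \<and> P = proj_pt p" if "P \<in> proj_space n" for P
    using that by (auto simp: proj_space_def)
  have forbidden: "proj_pt p \<in> forbidden_locus n d F \<longleftrightarrow> (\<exists>i\<le>m. p i = 0)"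
    if p: "p \<in> cvecs n" "p \<noteq> (\<lambda>_. 0)" for p
  proof -
    have "proj_pt p \<in> proj_space n" using p by (simp add: proj_space_def)
    then show ?thesis
      using waring_locus_monomial[OF assms(2) min d p]
      by (auto simp: forbidden_locus_def F minimal_iff)
  qed
  obtain p where p: "p \<in> cvecs n" "p \<noteq> (\<lambda>_. 0)" "\<forall>k\<le>n. p k ^ 2 = of_nat (e k)"
    "\<forall>k\<le>n. p k \<noteq> 0"
  proof (rule that)
    let ?p = "\<lambda>k. if k \<le> n then of_real (sqrt (real (e k))) else 0"
    show "?p \<in> cvecs n" by (simp add: cvecs_def)
    show "\<forall>k\<le>n. ?p k ^ 2 = of_nat (e k)" by (simp flip: of_real_power)
    show nz: "\<forall>k\<le>n. ?p k \<noteq> 0" using e1 by fastforce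
    then show "?p \<noteq> (\<lambda>_. 0)" by (metis le0)
  qed
  have crit: "proj_pt p \<in> eigenscheme n F"
    unfolding F by (rule critical_point_in_eigenscheme[OF p(1,2) e1 p(3)])
  have crit_waring: "proj_pt p \<in> waring_locus n d F"
    unfolding F waring_locus_monomial[OF assms(2) min d p(1,2)] using p(4) by blast
  have "forbidden_locus n d F \<subset> eigenscheme n F" if e2: "e 0 \<ge> 2"
  proof
    show "forbidden_locus n d F \<subseteq> eigenscheme n F"
    proof
      fix P assume P: "P \<in> forbidden_locus n d F"
      then obtain q where q: "q \<in> cvecs n" "q \<noteq> (\<lambda>_. 0)" "P = proj_pt q"
        using point[of P] by (auto simp: forbidden_locus_def)
      from P obtain i where i: "i \<le> n" "q i = 0" "e i = e 0"
        using forbidden[OF q(1,2)] by (auto simp: q(3) minimal_iff)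
      then have "\<forall>k\<le>n. \<exists>i\<le>n. q i = 0 \<and> (if i = k then 2 else 1) \<le> e i"
        using e2 by (intro allI impI exI[of _ i]) auto
      then show "P \<in> eigenscheme n F"
        unfolding F q(3) by (rule gradient_vanishes_imp_eigenscheme[OF q(1,2)])
    qed
    show "forbidden_locus n d F \<noteq> eigenscheme n F"
      using crit crit_waring by (auto simp: forbidden_locus_def)
  qed
  moreover have "eigenscheme n F \<inter> forbidden_locus n d F =
      (\<Union>i\<in>{0..m}. \<Union>j\<in>{0..n} - {i}. proj_zeros n {cX i, cX j})" (is "?L = ?R")
    if "\<not> e 0 \<ge> 2"
  proof -
    have e0: "e 0 = 1" using that assms(2) by simp
    have same: "proj_pt q \<in> ?L \<longleftrightarrow> proj_pt q \<in> ?R" if q: "q \<in> cvecs n" "q \<noteq> (\<lambda>_. 0)" for q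
    proof
      assume "proj_pt q \<in> ?L"
      then obtain i where i: "i \<le> m" "q i = 0" and eig: "proj_pt q \<in> eigenscheme n F"
        using forbidden[OF q] by auto
      from i(1) have ei: "i \<le> n" "e i = 1" using e0 by (auto simp: minimal_iff)
      obtain j where j: "j \<le> n" "j \<noteq> i"
        using assms(1) by (metis le0 le_trans one_le_numeral zero_neq_one)
      have "\<exists>k\<le>n. k \<noteq> i \<and> q k = 0"
      proof (rule ccontr)
        assume "\<not> ?thesis"
        then have "\<forall>k\<le>n. k \<noteq> i \<longrightarrow> q k \<noteq> 0" by blast
        from single_zero_not_in_eigenscheme[of q n i e j, OF q(1) ei i(2) this j] eig
        show False unfolding F by blast
      qed
      then obtain k where "k \<in> {0..n} - {i}" "q k = 0" by auto
      moreover have "i \<in> {0..m}" using i(1) by simp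
      ultimately show "proj_pt q \<in> ?R"
        unfolding UN_iff proj_zeros_coordinates[OF q] using i(2) by blast
    next
      assume "proj_pt q \<in> ?R"
      then obtain i j where "i \<in> {0..m}" "j \<in> {0..n} - {i}" "q i = 0" "q j = 0"
        unfolding UN_iff proj_zeros_coordinates[OF q] by blast
      then have ij: "i \<le> m" "j \<le> n" "j \<noteq> i" "q i = 0" "q j = 0" by auto
      have "i \<le> n" using ij(1) by (simp add: minimal_iff)
      have "\<exists>l\<le>n. q l = 0 \<and> (if l = k then 2 else 1) \<le> e l" for k
        using ij \<open>i \<le> n\<close> e1 by (cases "k = i") (auto intro: exI[of _ i] exI[of _ j])
      then have "proj_pt q \<in> eigenscheme n F"
        unfolding F by (intro gradient_vanishes_imp_eigenscheme[OF q]) blast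
      then show "proj_pt q \<in> ?L" using forbidden[OF q] ij by auto
    qed
    have inside: "P \<in> proj_space n" if "P \<in> ?L \<or> P \<in> ?R" for P
      using that by (auto simp: forbidden_locus_def proj_zeros_def)
    show ?thesis
    proof (rule set_eqI)
      fix P
      show "P \<in> ?L \<longleftrightarrow> P \<in> ?R"
      proof (cases "P \<in> proj_space n")
        case True
        then obtain q where q: "q \<in> cvecs n" "q \<noteq> (\<lambda>_. 0)" "P = proj_pt q"
          using point by blast
        show ?thesis unfolding q(3) by (rule same[OF q(1,2)])
      next
        case False
        then show ?thesis using inside[of P] by blast
      qed
    qed
  qed
  ultimately show ?thesis using crit crit_waring by blast
qed

end
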